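(* Let $X$ be a nonempty set and let $p,q,r,r'\in\mathbb{N}_{\mathrm{rd}}[X]\setminus\{0\}$ with $r\neq1\neq r'$ be such that $p\times_{\mathrm{rd}}r=q\times_{\mathrm{rd}}r'$ and $\mathrm{size}(r)=\mathrm{size}(r')$. Then $p=q$ and $r=r'$.
   Context: Terms. $\mathrm{T}(X)$ is the set of all terms built from elements of $X$, constants $\hat 0,\hat 1$, and binary symbols $\hat+,\hat\times$ (infix). $\mathrm{size}(t)$ is the total number of occurrences of symbols (elements of $X$, constants, binary symbols) in $t$. Simple terms. $s\in \mathrm{T}(X)$ is simple if $s=\hat 0$, or $s$ contains neither $\hat 0$ nor any subterm of the form $\hat 1\hat\times s'$ or $s'\hat\times\hat 1$. $\mathrm{ST}(X)$ is the set of simple terms. For $s,t\in \mathrm{ST}(X)$, $s=_{\mathrm{AC}}t$ means that $t$ is obtained from $s$ by finitely many steps, each replacing a subterm occurrence using, in either direction, one of: $a\hat+(b\hat+c)\leftrightarrow(a\hat+b)\hat+c$, $a\hat+b\leftrightarrow b\hat+a$, $a\hat\times(b\hat\times c)\leftrightarrow(a\hat\times b)\hat\times c$. $[s]_{\mathrm{AC}}$ is the class of $s$; $\mathbb{N}_{\mathrm{sb}}[X]=\mathrm{ST}(X)/{=_{\mathrm{AC}}}$; $0=[\hat 0]_{\mathrm{AC}}$, $1=[\hat 1]_{\mathrm{AC}}$; $X/\mathrm{AC}=\{[x]_{\mathrm{AC}}\mid x\in X\}$; $\mathrm{size}([s]_{\mathrm{AC}})=\mathrm{size}(s)$ (well defined).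 Operations on $\mathbb{N}_{\mathrm{sb}}[X]$: $p+0=0+p=p$, and $[s]_{\mathrm{AC}}+[t]_{\mathrm{AC}}=[s\hat+t]_{\mathrm{AC}}$ for $s,t\neq\hat 0$; $p\times 0=0\times p=0$, $p\times1=1\times p=p$, and $[s]_{\mathrm{AC}}\times[t]_{\mathrm{AC}}=[s\hat\times t]_{\mathrm{AC}}$ for $s,t\notin\{\hat 0,\hat 1\}$. Polynomials. A monomial term is a term built from elements of $X$ using only $\hat\times$; a monomial is the class of a monomial term. The set $\mathrm{PT}(X)$ of polynomial terms is the smallest $U\subseteq \mathrm{ST}(X)$ with: (a) $\hat 0,\hat 1$ and all monomial terms are in $U$; (b) if $s,t\in U\setminus\{\hat 0\}$ then $s\hat+t\in U$; (c) if $s$ is a monomial term and $t\in U\setminus\{\hat 0,\hat 1\}$ then $s\hat\times t\in U$. Terms arising by (b) (resp. (c)) are sum (resp. product) polynomial terms. $\mathbb{N}_{\mathrm{rd}}[X]=\{[t]_{\mathrm{AC}}\mid t\in \mathrm{PT}(X)\}$, whose elements are called polynomials; classes of sum (product) polynomial terms are sum (product) polynomials. Facts making the next definition meaningful: every polynomial outside $X/\mathrm{AC}\cup\{0,1\}$ is exactly one of a sum polynomial or a product polynomial; each sum polynomial is $q_1+\dots+q_n$ with $n\ge2$ and each $q_i$ a product polynomial or in $X/\mathrm{AC}\cup\{1\}$, uniquely up to permutation; each product polynomial that is not a monomial is $m\times q'$ for a unique monomial $m$ and unique sum polynomial $q'$. Multiplication $\times_{\mathrm{rd}}$ on $\mathbb{N}_{\mathrm{rd}}[X]$,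 by induction on $\mathrm{size}(q)$: $q\times_{\mathrm{rd}}0=0\times_{\mathrm{rd}}q=0$, $q\times_{\mathrm{rd}}1=1\times_{\mathrm{rd}}q=q$; for $q,r\notin\{0,1\}$: if $q$ is a monomial, $q\times_{\mathrm{rd}}r=q\times r$; if $q$ is a sum polynomial, written as $q=q_1+\dots+q_n$ with $n\ge2$ and each $q_i$ a product polynomial or in $X/\mathrm{AC}\cup\{1\}$, $q\times_{\mathrm{rd}}r=q_1\times_{\mathrm{rd}}r+\dots+q_n\times_{\mathrm{rd}}r$; if $q=m\times q'$ with $m$ a monomial and $q'$ a sum polynomial, $q\times_{\mathrm{rd}}r=m\times(q'\times_{\mathrm{rd}}r)$. *)

theory Defs
  imports "HOL-Library.Multiset"
begin

section \<open>Terms\<close>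

text \<open>The generating set is the universe of the type variable \<open>'x\<close>, which is automatically
  nonempty. The constructors \<open>\<oplus>\<close> and \<open>\<otimes>\<close> are the formal (hatted) addition and multiplication.\<close>

datatype 'x trm =
    Var 'x
  | Zero
  | One
  | Add "'x trm" "'x trm" (infixl "\<oplus>" 65)
  | Mul "'x trm" "'x trm" (infixl "\<otimes>" 70)

text \<open>The size function generated by the datatype package does not count the leaves, so it is
  not used here.\<close>

primrec term_size :: "'x trm \<Rightarrow> nat" where
  "term_size (Var x) = 1"
| "term_size Zero = 1"
| "term_size One = 1"
| "term_size (s \<oplus> t) = term_size s + term_size t + 1"
| "term_size (s \<otimes> t) = term_size s + term_size t + 1"

primrec subterms :: "'x trm \<Rightarrow> 'x trm set" where
  "subterms (Var x) = {Var x}"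
| "subterms Zero = {Zero}"
| "subterms One = {One}"
| "subterms (s \<oplus> t) = insert (s \<oplus> t) (subterms s \<union> subterms t)"
| "subterms (s \<otimes> t) = insert (s \<otimes> t) (subterms s \<union> subterms t)"

definition simple :: "'x trm \<Rightarrow> bool" where
  "simple s \<longleftrightarrow> s = Zero \<or>
    (Zero \<notin> subterms s \<and> (\<forall>s'. One \<otimes> s' \<notin> subterms s \<and> s' \<otimes> One \<notin> subterms s))"

lemma simple_leaf [simp]: "simple (Var x)" "simple Zero" "simple One"
  by (auto simp: simple_def)

lemma self_subterm [simp]: "s \<in> subterms s"
  by (cases s) auto

lemma simple_Add [simp]:
  "simple (s \<oplus> t) \<longleftrightarrow> simple s \<and> simple t \<and> s \<noteq> Zero \<and> t \<noteq> Zero"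
  by (auto simp: simple_def)

lemma simple_Mul [simp]:
  "simple (s \<otimes> t) \<longleftrightarrow>
    simple s \<and> simple t \<and> s \<noteq> Zero \<and> t \<noteq> Zero \<and> s \<noteq> One \<and> t \<noteq> One"
  by (auto simp: simple_def)


section \<open>Equality modulo AC and the quotient\<close>

text \<open>\<open>ac_step\<close> replaces one subterm occurrence using one of the rules, oriented from left to
  right. Its equivalence closure consists of finite sequences of steps in either direction; all
  terms in such a sequence are simple as soon as one of them is (\<open>ac_step_simple\<close>).\<close>

inductive ac_step :: "'x trm \<Rightarrow> 'x trm \<Rightarrow> bool" where
  add_assoc: "ac_step (a \<oplus> (b \<oplus> c)) ((a \<oplus> b) \<oplus> c)"
| add_comm: "ac_step (a \<oplus> b) (b \<oplus> a)"
| mul_assoc: "ac_step (a \<otimes> (b \<otimes> c)) ((a \<otimes> b) \<otimes> c)"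
| add_left: "ac_step a a' \<Longrightarrow> ac_step (a \<oplus> b) (a' \<oplus> b)"
| add_right: "ac_step b b' \<Longrightarrow> ac_step (a \<oplus> b) (a \<oplus> b')"
| mul_left: "ac_step a a' \<Longrightarrow> ac_step (a \<otimes> b) (a' \<otimes> b)"
| mul_right: "ac_step b b' \<Longrightarrow> ac_step (a \<otimes> b) (a \<otimes> b')"

definition ac_eq :: "'x trm \<Rightarrow> 'x trm \<Rightarrow> bool" (infix "=\<^sub>A\<^sub>C" 50) where
  "s =\<^sub>A\<^sub>C t \<longleftrightarrow> simple s \<and> simple t \<and> equivclp ac_step s t"

lemma ac_step_leaf:
  "ac_step s t \<Longrightarrow> s \<noteq> Zero \<and> t \<noteq> Zero \<and> s \<noteq> One \<and> t \<noteq> One"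
  by (induction rule: ac_step.induct) auto

lemma ac_step_simple: "ac_step s t \<Longrightarrow> simple s \<longleftrightarrow> simple t"
  by (induction rule: ac_step.induct) (auto dest: ac_step_leaf)

lemma equivclp_ac_step_simple: "equivclp ac_step s t \<Longrightarrow> simple s \<longleftrightarrow> simple t"
  by (induction rule: equivclp_induct) (auto dest: ac_step_simple)

lemma equivclp_ac_step_invariant:
  assumes "equivclp ac_step s t"
    and "\<And>s t. ac_step s t \<Longrightarrow> f s = f t"
  shows "f s = f t"
  using assms(1) by (induction rule: equivclp_induct) (auto dest: assms(2))

lemma ac_eq_invariant:
  assumes "s =\<^sub>A\<^sub>C t"
    and "\<And>s t. ac_step s t \<Longrightarrow> simple s \<Longrightarrow> simple t \<Longrightarrow> f s = f t"
  shows "f s = f t"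
proof -
  have "equivclp ac_step s t" "simple s"
    using assms(1) by (auto simp: ac_eq_def)
  then show ?thesis
  proof (induction rule: equivclp_induct)
    case (step y z)
    then show ?case
      by (metis ac_step_simple assms(2) equivclp_ac_step_simple)
  qed simp
qed

lemma ac_eq_refl: "simple s \<Longrightarrow> s =\<^sub>A\<^sub>C s"
  by (simp add: ac_eq_def)

lemma ac_eq_sym: "s =\<^sub>A\<^sub>C t \<Longrightarrow> t =\<^sub>A\<^sub>C s"
  by (auto simp: ac_eq_def intro: equivclp_sym)

lemma ac_eq_trans: "s =\<^sub>A\<^sub>C t \<Longrightarrow> t =\<^sub>A\<^sub>C u \<Longrightarrow> s =\<^sub>A\<^sub>C u"
  by (auto simp: ac_eq_def intro: equivclp_trans)

lemma ac_step_ac_eq: "ac_step s t \<Longrightarrow> simple s \<Longrightarrow> s =\<^sub>A\<^sub>C t"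
  by (auto simp: ac_eq_def dest: ac_step_simple)

lemma ac_eq_Zero_iff: "s =\<^sub>A\<^sub>C t \<Longrightarrow> s = Zero \<longleftrightarrow> t = Zero"
  by (erule ac_eq_invariant) (auto dest: ac_step_leaf)

lemma ac_eq_One_iff: "s =\<^sub>A\<^sub>C t \<Longrightarrow> s = One \<longleftrightarrow> t = One"
  by (erule ac_eq_invariant) (auto dest: ac_step_leaf)

lemma equivclp_cong:
  assumes "equivclp r s t" and "\<And>s t. r s t \<Longrightarrow> r (f s) (f t)"
  shows "equivclp r (f s) (f t)"
  using assms(1)
  by (induction rule: equivclp_induct) (auto intro: assms(2) equivclp_into_equivclp)

lemma ac_eq_Add:
  assumes "s =\<^sub>A\<^sub>C s'" "t =\<^sub>A\<^sub>C t'" "s \<noteq> Zero" "t \<noteq> Zero"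
  shows "s \<oplus> t =\<^sub>A\<^sub>C s' \<oplus> t'"
proof -
  have "equivclp ac_step (s \<oplus> t) (s' \<oplus> t)"
    by (rule equivclp_cong[where f = "\<lambda>u. u \<oplus> t"])
      (use assms in \<open>auto simp: ac_eq_def intro: ac_step.intros\<close>)
  moreover have "equivclp ac_step (s' \<oplus> t) (s' \<oplus> t')"
    by (rule equivclp_cong) (use assms in \<open>auto simp: ac_eq_def intro: ac_step.intros\<close>)
  ultimately have "equivclp ac_step (s \<oplus> t) (s' \<oplus> t')"
    by (rule equivclp_trans)
  with assms show ?thesis
    by (auto simp: ac_eq_def dest: ac_eq_Zero_iff equivclp_ac_step_simple)
qed

lemma ac_eq_Mul:
  assumes "s =\<^sub>A\<^sub>C s'" "t =\<^sub>A\<^sub>C t'" "s \<noteq> Zero" "t \<noteq> Zero" "s \<noteq> One" "t \<noteq> One"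
  shows "s \<otimes> t =\<^sub>A\<^sub>C s' \<otimes> t'"
proof -
  have "equivclp ac_step (s \<otimes> t) (s' \<otimes> t)"
    by (rule equivclp_cong[where f = "\<lambda>u. u \<otimes> t"])
      (use assms in \<open>auto simp: ac_eq_def intro: ac_step.intros\<close>)
  moreover have "equivclp ac_step (s' \<otimes> t) (s' \<otimes> t')"
    by (rule equivclp_cong) (use assms in \<open>auto simp: ac_eq_def intro: ac_step.intros\<close>)
  ultimately have "equivclp ac_step (s \<otimes> t) (s' \<otimes> t')"
    by (rule equivclp_trans)
  with assms show ?thesis
    by (auto simp: ac_eq_def dest: equivclp_ac_step_simple)
qed

text \<open>\<open>'x nsb\<close> is the set of simple terms modulo \<open>=\<^sub>A\<^sub>C\<close>. The relation \<open>=\<^sub>A\<^sub>C\<close> is a partial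
  equivalence on all terms whose domain is the set of simple terms. For a simple term \<open>t\<close>, its
  class is \<open>abs_nsb t\<close>; on terms that are not simple \<open>abs_nsb\<close> has no meaning.\<close>

quotient_type 'x nsb = "'x trm" / partial: ac_eq
proof (rule part_equivpI)
  show "\<exists>t::'x trm. t =\<^sub>A\<^sub>C t"
    using ac_eq_refl simple_leaf(2) by blast
  show "symp (ac_eq :: 'x trm \<Rightarrow> _)"
    by (auto intro!: sympI ac_eq_sym)
  show "transp (ac_eq :: 'x trm \<Rightarrow> _)"
    by (auto intro!: transpI dest: ac_eq_trans)
qed

lift_definition size_nsb :: "'x nsb \<Rightarrow> nat" is term_size
proof -
  fix s t :: "'x trm"
  assume "s =\<^sub>A\<^sub>C t"
  moreover have "term_size s = term_size t" if "ac_step s t" for s t :: "'x trm"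
    using that by induction auto
  ultimately show "term_size s = term_size t"
    by (rule ac_eq_invariant)
qed

instantiation nsb :: (type) "{zero, one, plus, times}"
begin

lift_definition zero_nsb :: "'x nsb" is Zero
  by (simp add: ac_eq_refl)

lift_definition one_nsb :: "'x nsb" is One
  by (simp add: ac_eq_refl)

lift_definition plus_nsb :: "'x nsb \<Rightarrow> 'x nsb \<Rightarrow> 'x nsb" is
  "\<lambda>s t. if s = Zero then t else if t = Zero then s else s \<oplus> t"
  subgoal for s s' t t'
    using ac_eq_Zero_iff[of s s'] ac_eq_Zero_iff[of t t'] ac_eq_Add[of s s' t t'] by auto
  done

lift_definition times_nsb :: "'x nsb \<Rightarrow> 'x nsb \<Rightarrow> 'x nsb" is
  "\<lambda>s t. if s = Zero \<or> t = Zero then Zero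
    else if s = One then t else if t = One then s else s \<otimes> t"
  subgoal for s s' t t'
    using ac_eq_Zero_iff[of s s'] ac_eq_Zero_iff[of t t'] ac_eq_One_iff[of s s']
      ac_eq_One_iff[of t t'] ac_eq_Mul[of s s' t t'] ac_eq_refl[OF simple_leaf(2)]
    by auto
  done

instance ..

end

lemma ac_eq_simple: "s =\<^sub>A\<^sub>C t \<Longrightarrow> simple s" "s =\<^sub>A\<^sub>C t \<Longrightarrow> simple t"
  by (auto simp: ac_eq_def)

instance nsb :: (type) "{comm_monoid_add, monoid_mult, mult_zero, zero_neq_one}"
proof
  fix a b c :: "'x nsb"
  show "a + b + c = a + (b + c)"
    by transfer (auto simp: ac_eq_simple intro!: ac_eq_refl ac_eq_sym[OF ac_step_ac_eq] add_assoc)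
  show "a + b = b + a"
    by transfer (auto simp: ac_eq_simple intro!: ac_eq_refl ac_step_ac_eq add_comm)
  show "0 + a = a"
    by transfer (auto simp: ac_eq_simple)
  show "a * b * c = a * (b * c)"
    by transfer (auto simp: ac_eq_simple intro!: ac_eq_refl ac_eq_sym[OF ac_step_ac_eq] mul_assoc)
  show "1 * a = a" "a * 1 = a" "0 * a = 0" "a * 0 = 0"
    by (transfer, auto simp: ac_eq_simple intro!: ac_eq_refl)+
  show "0 \<noteq> (1 :: 'x nsb)"
    by transfer (auto dest: ac_eq_Zero_iff)
qed


section \<open>Polynomials\<close>

inductive_set monomial_terms :: "'x trm set" where
  "Var x \<in> monomial_terms"
| "s \<in> monomial_terms \<Longrightarrow> t \<in> monomial_terms \<Longrightarrow> s \<otimes> t \<in> monomial_terms"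

inductive_set poly_terms :: "'x trm set" where
  Zero: "Zero \<in> poly_terms"
| One: "One \<in> poly_terms"
| monomial: "s \<in> monomial_terms \<Longrightarrow> s \<in> poly_terms"
| sum: "s \<in> poly_terms \<Longrightarrow> s \<noteq> Zero \<Longrightarrow> t \<in> poly_terms \<Longrightarrow> t \<noteq> Zero \<Longrightarrow> s \<oplus> t \<in> poly_terms"
| product: "s \<in> monomial_terms \<Longrightarrow> t \<in> poly_terms \<Longrightarrow> t \<noteq> Zero \<Longrightarrow> t \<noteq> One \<Longrightarrow>
    s \<otimes> t \<in> poly_terms"

definition sum_poly_terms :: "'x trm set" where
  "sum_poly_terms = {s \<oplus> t | s t. s \<in> poly_terms - {Zero} \<and> t \<in> poly_terms - {Zero}}"

definition product_poly_terms :: "'x trm set" where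
  "product_poly_terms = {s \<otimes> t | s t. s \<in> monomial_terms \<and> t \<in> poly_terms - {Zero, One}}"

definition nrd :: "'x nsb set" where
  "nrd = abs_nsb ` poly_terms"

definition indeterminates :: "'x nsb set" where
  "indeterminates = range (\<lambda>x. abs_nsb (Var x))"

definition monomials :: "'x nsb set" where
  "monomials = abs_nsb ` monomial_terms"

definition sum_polys :: "'x nsb set" where
  "sum_polys = abs_nsb ` sum_poly_terms"

definition product_polys :: "'x nsb set" where
  "product_polys = abs_nsb ` product_poly_terms"

definition sum_decomp :: "'x nsb \<Rightarrow> 'x nsb multiset \<Rightarrow> bool" where
  "sum_decomp q M \<longleftrightarrow>
    size M \<ge> 2 \<and> set_mset M \<subseteq> product_polys \<union> indeterminates \<union> {1} \<and> q = \<Sum>\<^sub># M"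

definition product_decomp :: "'x nsb \<Rightarrow> 'x nsb \<times> 'x nsb \<Rightarrow> bool" where
  "product_decomp q mq \<longleftrightarrow> fst mq \<in> monomials \<and> snd mq \<in> sum_polys \<and> q = fst mq * snd mq"


subsection \<open>The decompositions exist and are unique\<close>

lemma monomial_terms_simple:
  "s \<in> monomial_terms \<Longrightarrow> simple s \<and> s \<noteq> Zero \<and> s \<noteq> One"
  by (induction rule: monomial_terms.induct) auto

lemma poly_terms_simple: "s \<in> poly_terms \<Longrightarrow> simple s"
  by (induction rule: poly_terms.induct) (auto dest: monomial_terms_simple)

lemma abs_nsb_eq_iff: "simple s \<Longrightarrow> abs_nsb s = abs_nsb t \<and> simple t \<longleftrightarrow> s =\<^sub>A\<^sub>C t"
  using Quotient3_rel[OF Quotient3_nsb, of s t]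
  by (auto simp: ac_eq_refl ac_eq_simple)

lemma abs_nsb_eqI: "s =\<^sub>A\<^sub>C t \<Longrightarrow> abs_nsb s = abs_nsb t"
  using abs_nsb_eq_iff ac_eq_simple(1) by blast

lemma rep_nsb_ac_eq: "simple s \<Longrightarrow> rep_nsb (abs_nsb s) =\<^sub>A\<^sub>C s"
  by (simp add: Quotient3_nsb ac_eq_refl rep_abs_rsp_left)

lemma simple_rep_nsb: "simple (rep_nsb p)" and abs_rep_nsb [simp]: "abs_nsb (rep_nsb p) = p"
  using Quotient3_rep_reflp[OF Quotient3_nsb, of p] Quotient3_abs_rep[OF Quotient3_nsb, of p]
  by (auto simp: ac_eq_simple)

lemma nsb_cases: obtains s where "simple s" "p = abs_nsb s"
  using simple_rep_nsb abs_rep_nsb by metis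

lemma abs_nsb_Zero: "abs_nsb Zero = 0" and abs_nsb_One: "abs_nsb One = 1"
  by (simp_all add: zero_nsb.abs_eq one_nsb.abs_eq)

lemma abs_nsb_eq_0_iff: "simple s \<Longrightarrow> abs_nsb s = 0 \<longleftrightarrow> s = Zero"
  by (metis abs_nsb_Zero abs_nsb_eq_iff ac_eq_Zero_iff simple_leaf(2))

lemma abs_nsb_eq_1_iff: "simple s \<Longrightarrow> abs_nsb s = 1 \<longleftrightarrow> s = One"
  by (metis abs_nsb_One abs_nsb_eq_iff ac_eq_One_iff simple_leaf(3))

lemma abs_nsb_Add: "simple (s \<oplus> t) \<Longrightarrow> abs_nsb (s \<oplus> t) = abs_nsb s + abs_nsb t"
  by (simp add: plus_nsb.abs_eq ac_eq_refl)

lemma abs_nsb_Mul: "simple (s \<otimes> t) \<Longrightarrow> abs_nsb (s \<otimes> t) = abs_nsb s * abs_nsb t"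
  by (simp add: times_nsb.abs_eq ac_eq_refl)

lemma size_abs_nsb: "simple s \<Longrightarrow> size_nsb (abs_nsb s) = term_size s"
  by (simp add: size_nsb.abs_eq ac_eq_refl)

primrec summands_trm :: "'x trm \<Rightarrow> 'x nsb multiset" where
  "summands_trm (Var x) = {#abs_nsb (Var x)#}"
| "summands_trm Zero = {#0#}"
| "summands_trm One = {#1#}"
| "summands_trm (s \<oplus> t) = summands_trm s + summands_trm t"
| "summands_trm (s \<otimes> t) = {#abs_nsb (s \<otimes> t)#}"

primrec factors_trm :: "'x trm \<Rightarrow> 'x nsb list" where
  "factors_trm (Var x) = [abs_nsb (Var x)]"
| "factors_trm Zero = [0]"
| "factors_trm One = [1]"
| "factors_trm (s \<oplus> t) = [abs_nsb (s \<oplus> t)]"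
| "factors_trm (s \<otimes> t) = factors_trm s @ factors_trm t"

lemma summands_trm_step:
  "ac_step s t \<Longrightarrow> simple s \<Longrightarrow> summands_trm s = summands_trm t"
proof (induction rule: ac_step.induct)
  case (mul_assoc a b c)
  then show ?case
    by (auto intro!: abs_nsb_eqI ac_step_ac_eq ac_step.mul_assoc)
next
  case (mul_left a a' b)
  then show ?case
    by (auto intro!: abs_nsb_eqI ac_step_ac_eq ac_step.mul_left)
next
  case (mul_right b b' a)
  then show ?case
    by (auto intro!: abs_nsb_eqI ac_step_ac_eq ac_step.mul_right)
qed auto

lemma factors_trm_step:
  "ac_step s t \<Longrightarrow> simple s \<Longrightarrow> factors_trm s = factors_trm t"
proof (induction rule: ac_step.induct)
  case (add_assoc a b c)
  then show ?case
    by (auto intro!: abs_nsb_eqI ac_step_ac_eq ac_step.add_assoc)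
next
  case (add_comm a b)
  then show ?case
    by (auto intro!: abs_nsb_eqI ac_step_ac_eq ac_step.add_comm)
next
  case (add_left a a' b)
  then show ?case
    by (auto intro!: abs_nsb_eqI ac_step_ac_eq ac_step.add_left)
next
  case (add_right b b' a)
  then show ?case
    by (auto intro!: abs_nsb_eqI ac_step_ac_eq ac_step.add_right)
qed auto

definition summands :: "'x nsb \<Rightarrow> 'x nsb multiset" where
  "summands p = summands_trm (rep_nsb p)"

definition factors :: "'x nsb \<Rightarrow> 'x nsb list" where
  "factors p = factors_trm (rep_nsb p)"

lemma summands_abs: "simple s \<Longrightarrow> summands (abs_nsb s) = summands_trm s"
  unfolding summands_def by (erule ac_eq_invariant[OF rep_nsb_ac_eq]) (rule summands_trm_step)

lemma factors_abs: "simple s \<Longrightarrow> factors (abs_nsb s) = factors_trm s"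
  unfolding factors_def by (erule ac_eq_invariant[OF rep_nsb_ac_eq]) (rule factors_trm_step)

lemma summands_add: "p \<noteq> 0 \<Longrightarrow> q \<noteq> 0 \<Longrightarrow> summands (p + q) = summands p + summands q"
proof (cases p rule: nsb_cases; cases q rule: nsb_cases)
  fix s t
  assume "p \<noteq> 0" "q \<noteq> 0" and st: "simple s" "p = abs_nsb s" "simple t" "q = abs_nsb t"
  then have "simple (s \<oplus> t)"
    by (auto simp: abs_nsb_Zero)
  with st show ?thesis
    by (simp add: abs_nsb_Add[symmetric] summands_abs del: simple_Add)
qed

lemma factors_mult:
  "p \<noteq> 0 \<Longrightarrow> q \<noteq> 0 \<Longrightarrow> p \<noteq> 1 \<Longrightarrow> q \<noteq> 1 \<Longrightarrow> factors (p * q) = factors p @ factors q"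
proof (cases p rule: nsb_cases; cases q rule: nsb_cases)
  fix s t
  assume "p \<noteq> 0" "q \<noteq> 0" "p \<noteq> 1" "q \<noteq> 1"
    and st: "simple s" "p = abs_nsb s" "simple t" "q = abs_nsb t"
  then have "simple (s \<otimes> t)"
    by (auto simp: abs_nsb_Zero abs_nsb_One)
  with st show ?thesis
    by (simp add: abs_nsb_Mul[symmetric] factors_abs del: simple_Mul)
qed

lemma sum_mset_summands_trm: "simple s \<Longrightarrow> \<Sum>\<^sub># (summands_trm s) = abs_nsb s"
  by (induction s) (auto simp: abs_nsb_Zero abs_nsb_One abs_nsb_Add)

lemma prod_list_factors_trm: "simple s \<Longrightarrow> prod_list (factors_trm s) = abs_nsb s"
  by (induction s) (auto simp: abs_nsb_Zero abs_nsb_One abs_nsb_Mul)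

lemma prod_list_factors: "prod_list (factors p) = p"
  by (simp add: factors_def prod_list_factors_trm simple_rep_nsb)

lemma term_size_pos: "term_size s > 0"
  by (cases s) auto

lemma summands_trm_neq_empty: "summands_trm s \<noteq> {#}"
  by (induction s) auto

lemma product_poly_terms_subset: "product_poly_terms \<subseteq> poly_terms"
  and sum_poly_terms_subset: "sum_poly_terms \<subseteq> poly_terms"
  by (auto simp: product_poly_terms_def sum_poly_terms_def
      intro: poly_terms.sum poly_terms.product)

lemma summand_nonzero:
  assumes "q \<in> product_polys \<union> indeterminates \<union> {1}"
  shows "q \<noteq> 0 \<and> summands q = {#q#}"
proof -
  consider "q \<in> product_polys" | "q \<in> indeterminates" | "q = 1"
    using assms by blast
  then show ?thesis
  proof cases
    case 1
    then obtain s t where q: "q = abs_nsb (s \<otimes> t)" "s \<otimes> t \<in> product_poly_terms"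
      by (auto simp: product_polys_def product_poly_terms_def)
    then have "simple (s \<otimes> t)"
      using product_poly_terms_subset poly_terms_simple by blast
    with q show ?thesis
      by (simp add: abs_nsb_eq_0_iff summands_abs del: simple_Mul)
  next
    case 2
    then show ?thesis
      by (auto simp: indeterminates_def abs_nsb_eq_0_iff summands_abs)
  next
    case 3
    then show ?thesis
      by (simp add: summands_abs flip: abs_nsb_One) (simp add: abs_nsb_eq_0_iff)
  qed
qed

lemma add_neq_0: "p \<noteq> 0 \<Longrightarrow> p + q \<noteq> 0" for p q :: "'x nsb"
  by (cases p rule: nsb_cases; cases q rule: nsb_cases)
    (auto simp: plus_nsb.abs_eq ac_eq_refl abs_nsb_eq_0_iff)

lemma summands_sum_mset:
  assumes "set_mset M \<subseteq> product_polys \<union> indeterminates \<union> {1}" and "M \<noteq> {#}"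
  shows "\<Sum>\<^sub># M \<noteq> 0 \<and> summands (\<Sum>\<^sub># M) = M"
  using assms
proof (induction M)
  case (add q M)
  have q: "q \<noteq> 0" "summands q = {#q#}"
    using add.prems summand_nonzero by auto
  show ?case
  proof (cases "M = {#}")
    case False
    then have IH: "\<Sum>\<^sub># M \<noteq> 0" "summands (\<Sum>\<^sub># M) = M"
      using add by auto
    have "q + \<Sum>\<^sub># M \<noteq> 0"
      using q(1) by (rule add_neq_0)
    with q IH show ?thesis
      by (simp add: summands_add)
  qed (use q in simp)
qed simp

lemma sum_decomp_summands: "sum_decomp q M \<Longrightarrow> summands q = M"
  using summands_sum_mset[of M] by (cases "M = {#}") (auto simp: sum_decomp_def)

lemma sum_decomp_unique: "sum_decomp q M \<Longrightarrow> sum_decomp q M' \<Longrightarrow> M = M'"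
  using sum_decomp_summands by metis

lemma monomial_terms_cases:
  assumes "s \<in> monomial_terms"
  shows "abs_nsb s \<in> product_polys \<union> indeterminates"
  using assms
proof (cases rule: monomial_terms.cases)
  case (2 s t)
  then have "s \<otimes> t \<in> product_poly_terms"
    by (auto simp: product_poly_terms_def intro: poly_terms.monomial dest: monomial_terms_simple)
  with 2 show ?thesis
    by (auto simp: product_polys_def)
qed (auto simp: indeterminates_def)

lemma monomial_term_summands: "s \<in> monomial_terms \<Longrightarrow> summands_trm s = {#abs_nsb s#}"
  by (cases rule: monomial_terms.cases) auto

lemma poly_term_summands:
  "t \<in> poly_terms \<Longrightarrow> t \<noteq> Zero \<Longrightarrow>
    set_mset (summands_trm t) \<subseteq> product_polys \<union> indeterminates \<union> {1}"
proof (induction rule: poly_terms.induct)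
  case (monomial s)
  then show ?case
    using monomial_terms_cases[of s] by (auto simp: monomial_term_summands)
next
  case (product s t)
  then have "s \<otimes> t \<in> product_poly_terms"
    by (auto simp: product_poly_terms_def)
  then show ?case
    by (auto simp: product_polys_def)
qed auto

lemma sum_decomp_exists:
  assumes "q \<in> sum_polys"
  shows "\<exists>M. sum_decomp q M"
proof -
  obtain s t where q: "q = abs_nsb (s \<oplus> t)" and st: "s \<oplus> t \<in> poly_terms"
    using assms sum_poly_terms_subset by (fastforce simp: sum_polys_def sum_poly_terms_def)
  have "size (summands_trm s) > 0" "size (summands_trm t) > 0"
    using summands_trm_neq_empty by (auto simp: nonempty_has_size)
  then have "sum_decomp q (summands_trm (s \<oplus> t))"
    unfolding sum_decomp_def
    using poly_term_summands[OF st] sum_mset_summands_trm[OF poly_terms_simple[OF st]] q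
    by auto
  then show ?thesis ..
qed

lemma sum_decomp_THE:
  assumes "q \<in> sum_polys"
  shows "sum_decomp q (THE M. sum_decomp q M)"
  using sum_decomp_exists[OF assms] sum_decomp_unique by (metis theI)

lemma monomials_neq: "m \<in> monomials \<Longrightarrow> m \<noteq> 0 \<and> m \<noteq> 1"
  by (auto simp: monomials_def abs_nsb_eq_0_iff abs_nsb_eq_1_iff dest: monomial_terms_simple)

lemma sum_poly_neq_factors:
  assumes "q \<in> sum_polys"
  shows "q \<noteq> 0 \<and> q \<noteq> 1 \<and> factors q = [q]"
proof -
  obtain s t where q: "q = abs_nsb (s \<oplus> t)" "s \<oplus> t \<in> sum_poly_terms"
    using assms by (auto simp: sum_polys_def sum_poly_terms_def)
  then have "simple (s \<oplus> t)"
    using sum_poly_terms_subset poly_terms_simple by blast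
  with q show ?thesis
    by (simp add: factors_abs abs_nsb_eq_0_iff abs_nsb_eq_1_iff del: simple_Add)
qed

lemma product_decomp_unique: "product_decomp q d \<Longrightarrow> product_decomp q d' \<Longrightarrow> d = d'"
proof -
  assume "product_decomp q d" "product_decomp q d'"
  then have "factors q = factors (fst d) @ [snd d]" "factors q = factors (fst d') @ [snd d']"
    using factors_mult monomials_neq sum_poly_neq_factors
    unfolding product_decomp_def by metis+
  then have "factors (fst d) = factors (fst d')" "snd d = snd d'"
    by auto
  then show "d = d'"
    by (metis prod_list_factors prod_eqI)
qed

lemma monomials_mult: "m \<in> monomials \<Longrightarrow> m' \<in> monomials \<Longrightarrow> m * m' \<in> monomials"
  unfolding monomials_def
proof clarify
  fix s t :: "'x trm"
  assume "s \<in> monomial_terms" "t \<in> monomial_terms"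
  then have "s \<otimes> t \<in> monomial_terms"
    by (rule monomial_terms.intros)
  moreover from this have "abs_nsb s * abs_nsb t = abs_nsb (s \<otimes> t)"
    by (metis abs_nsb_Mul monomial_terms_simple)
  ultimately show "abs_nsb s * abs_nsb t \<in> abs_nsb ` monomial_terms"
    by simp
qed

lemma poly_term_cases:
  "t \<in> poly_terms \<Longrightarrow> t = Zero \<or> t = One \<or> abs_nsb t \<in> monomials \<or> abs_nsb t \<in> sum_polys \<or>
    (\<exists>d. product_decomp (abs_nsb t) d)"
proof (induction rule: poly_terms.induct)
  case (sum s t)
  then show ?case
    by (auto simp: sum_polys_def sum_poly_terms_def)
next
  case (product s t)
  have st: "abs_nsb (s \<otimes> t) = abs_nsb s * abs_nsb t"
    using product poly_terms.product[of s t] by (intro abs_nsb_Mul poly_terms_simple) auto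
  have s: "abs_nsb s \<in> monomials"
    using product by (auto simp: monomials_def)
  consider "abs_nsb t \<in> monomials" | "abs_nsb t \<in> sum_polys"
    | d where "product_decomp (abs_nsb t) d"
    using product by auto
  then show ?case
  proof cases
    case 1
    then show ?thesis
      using s st monomials_mult by metis
  next
    case 2
    then have "product_decomp (abs_nsb (s \<otimes> t)) (abs_nsb s, abs_nsb t)"
      using s st by (simp add: product_decomp_def)
    then show ?thesis by blast
  next
    case 3
    then have "product_decomp (abs_nsb (s \<otimes> t)) (abs_nsb s * fst d, snd d)"
      using s st monomials_mult by (auto simp: product_decomp_def mult.assoc)
    then show ?thesis by blast
  qed
qed (auto simp: monomials_def)

lemma sum_product_disjoint: "sum_polys \<inter> (product_polys \<union> indeterminates \<union> {0, 1}) = {}"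
proof -
  have "False" if q: "q \<in> sum_polys" "q \<in> product_polys \<union> indeterminates \<union> {1}" for q :: "'x nsb"
  proof -
    obtain M where M: "sum_decomp q M"
      using q(1) sum_decomp_exists by blast
    then have "M = {#q#}"
      using q(2) sum_decomp_summands summand_nonzero by metis
    with M show False
      by (simp add: sum_decomp_def)
  qed
  with sum_poly_neq_factors show ?thesis by fastforce
qed

lemma product_decomp_exists:
  assumes "q \<in> product_polys" "q \<notin> monomials"
  shows "\<exists>d. product_decomp q d"
proof -
  obtain t where t: "q = abs_nsb t" "t \<in> poly_terms"
    using assms product_poly_terms_subset by (auto simp: product_polys_def)
  moreover have "q \<noteq> 0" "q \<noteq> 1" "q \<notin> sum_polys"
  proof -
    show "q \<noteq> 0" "q \<notin> sum_polys"
      using assms summand_nonzero[of q] sum_product_disjoint by auto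
    obtain t' where "q = abs_nsb t'" "t' \<in> product_poly_terms"
      using assms by (auto simp: product_polys_def)
    moreover from this have "simple t'" "t' \<noteq> One"
      using product_poly_terms_subset poly_terms_simple by (auto simp: product_poly_terms_def)
    ultimately show "q \<noteq> 1"
      by (simp add: abs_nsb_eq_1_iff)
  qed
  ultimately show ?thesis
    using poly_term_cases[OF t(2)] assms by (auto simp: abs_nsb_Zero abs_nsb_One)
qed

lemma product_decomp_THE:
  assumes "q \<in> product_polys" "q \<notin> monomials"
  shows "product_decomp q (THE d. product_decomp q d)"
  using product_decomp_exists[OF assms] product_decomp_unique by (metis theI)

lemma nrd_cases:
  assumes "q \<in> nrd"
  shows "q \<in> indeterminates \<union> {0, 1} \<union> sum_polys \<union> product_polys"
proof -
  obtain t where q: "q = abs_nsb t" and "t \<in> poly_terms"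
    using assms by (auto simp: nrd_def)
  from this(2) show ?thesis
  proof cases
    case monomial
    then show ?thesis
      using q monomial_terms_cases by auto
  qed (use q in \<open>auto simp: abs_nsb_Zero abs_nsb_One sum_polys_def sum_poly_terms_def
      product_polys_def product_poly_terms_def\<close>)
qed

lemma size_nsb_pos: "size_nsb p > 0"
  by (cases p rule: nsb_cases) (simp add: size_abs_nsb term_size_pos)

lemma size_nsb_add: "p \<noteq> 0 \<Longrightarrow> q \<noteq> 0 \<Longrightarrow> size_nsb (p + q) = size_nsb p + size_nsb q + 1"
  by transfer (auto simp: ac_eq_refl ac_eq_simple)

lemma size_nsb_mult:
  "p \<noteq> 0 \<Longrightarrow> q \<noteq> 0 \<Longrightarrow> p \<noteq> 1 \<Longrightarrow> q \<noteq> 1 \<Longrightarrow> size_nsb (p * q) = size_nsb p + size_nsb q + 1"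
  by transfer (auto simp: ac_eq_refl ac_eq_simple)

lemma size_sum_decomp:
  assumes "sum_decomp q M" "q' \<in># M"
  shows "size_nsb q' < size_nsb q"
proof -
  obtain M' where M: "M = add_mset q' M'"
    using assms(2) by (meson multi_member_split)
  then have "M' \<noteq> {#}"
    using assms(1) by (auto simp: sum_decomp_def)
  then have "\<Sum>\<^sub># M' \<noteq> 0" "q' \<noteq> 0"
    using assms(1) M summands_sum_mset[of M'] summand_nonzero[of q'] by (auto simp: sum_decomp_def)
  then show ?thesis
    using assms(1) M by (simp add: sum_decomp_def size_nsb_add)
qed

lemma size_product_decomp: "product_decomp q d \<Longrightarrow> size_nsb (snd d) < size_nsb q"
  by (auto simp: product_decomp_def size_nsb_mult dest!: monomials_neq sum_poly_neq_factors)


subsection \<open>Multiplication of polynomials\<close>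

text \<open>The operation is only meaningful on \<open>nrd\<close>; the last alternative is never reached there.\<close>

function times_rd :: "'x nsb \<Rightarrow> 'x nsb \<Rightarrow> 'x nsb" (infixl "\<times>\<^sub>r\<^sub>d" 70) where
  "q \<times>\<^sub>r\<^sub>d r =
    (if q = 0 \<or> r = 0 then 0
     else if q = 1 then r
     else if r = 1 then q
     else if q \<in> monomials then q * r
     else if q \<in> sum_polys then \<Sum>\<^sub># (image_mset (\<lambda>q'. q' \<times>\<^sub>r\<^sub>d r) (THE M. sum_decomp q M))
     else if q \<in> product_polys then
       fst (THE d. product_decomp q d) * (snd (THE d. product_decomp q d) \<times>\<^sub>r\<^sub>d r)
     else undefined)"
  by pat_completeness auto
termination
  by (relation "measure (\<lambda>(q, r). size_nsb q)")
    (auto intro: size_sum_decomp[OF sum_decomp_THE] size_product_decomp[OF product_decomp_THE])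

declare times_rd.simps [simp del]

text \<open>The recursive equations, for an arbitrary choice of the decompositions.\<close>

lemma times_rd_0: "q \<times>\<^sub>r\<^sub>d 0 = 0" "0 \<times>\<^sub>r\<^sub>d q = 0"
  and times_rd_1: "q \<times>\<^sub>r\<^sub>d 1 = q" "1 \<times>\<^sub>r\<^sub>d q = q"
  by (subst times_rd.simps, simp)+

lemma times_rd_monomial: "q \<in> monomials \<Longrightarrow> q \<times>\<^sub>r\<^sub>d r = q * r"
  by (subst times_rd.simps) (auto simp: monomials_neq)

lemma monomials_subset: "monomials \<subseteq> product_polys \<union> indeterminates"
  using monomial_terms_cases by (auto simp: monomials_def)

lemma times_rd_sum:
  assumes "q \<in> sum_polys" "sum_decomp q M" "r \<noteq> 0" "r \<noteq> 1"
  shows "q \<times>\<^sub>r\<^sub>d r = (\<Sum>q'\<in>#M. q' \<times>\<^sub>r\<^sub>d r)"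
proof -
  have "(THE M. sum_decomp q M) = M"
    using assms sum_decomp_unique by blast
  moreover have "q \<noteq> 0" "q \<noteq> 1" "q \<notin> monomials"
    using assms(1) sum_product_disjoint monomials_subset by auto
  ultimately show ?thesis
    using assms by (subst times_rd.simps) simp
qed

lemma times_rd_product:
  assumes "m \<in> monomials" "q' \<in> sum_polys" "r \<noteq> 0" "r \<noteq> 1"
  shows "(m * q') \<times>\<^sub>r\<^sub>d r = m * (q' \<times>\<^sub>r\<^sub>d r)"
proof -
  obtain s t where s: "s \<in> monomial_terms" "m = abs_nsb s"
    and t: "t \<in> sum_poly_terms" "q' = abs_nsb t"
    using assms by (auto simp: monomials_def sum_polys_def)
  have t': "t \<in> poly_terms - {Zero, One}"
    using t(1) sum_poly_terms_subset by (auto simp: sum_poly_terms_def)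
  have simp_st: "simple (s \<otimes> t)"
    using s(1) t' by (auto dest: monomial_terms_simple poly_terms_simple)
  have st: "m * q' = abs_nsb (s \<otimes> t)" "s \<otimes> t \<in> product_poly_terms"
    using s t t' abs_nsb_Mul[OF simp_st] by (auto simp: product_poly_terms_def)
  have prod: "m * q' \<in> product_polys"
    using st by (auto simp: product_polys_def)
  have d: "product_decomp (m * q') (m, q')"
    using assms by (simp add: product_decomp_def)
  have the: "(THE d. product_decomp (m * q') d) = (m, q')"
    using d product_decomp_unique by blast
  have neq: "m * q' \<noteq> 0" "m * q' \<noteq> 1"
    using st(1) simp_st by (auto simp: abs_nsb_eq_0_iff abs_nsb_eq_1_iff simp del: simple_Mul)
  have not_sum: "m * q' \<notin> sum_polys"
    using prod sum_product_disjoint by auto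
  have ind: "set (factors p) \<subseteq> indeterminates" if "p \<in> monomials" for p :: "'x nsb"
  proof -
    have "set (factors_trm u) \<subseteq> indeterminates" if "u \<in> monomial_terms" for u :: "'x trm"
      using that by induction (auto simp: indeterminates_def)
    then show ?thesis
      using that by (fastforce simp: monomials_def factors_abs monomial_terms_simple)
  qed
  have "m * q' \<notin> monomials"
  proof
    assume "m * q' \<in> monomials"
    moreover have "q' \<in> set (factors (m * q'))"
      using assms factors_mult[of m q'] monomials_neq[of m] sum_poly_neq_factors[of q'] by auto
    ultimately have "q' \<in> indeterminates"
      using ind by blast
    with assms(2) sum_product_disjoint show False by blast
  qed
  with the neq not_sum prod assms show ?thesis
    by (subst times_rd.simps) simp
qed

end

theory Submission
  imports Defs
begin

text \<open>
  A polynomial other than \<open>0\<close> and \<open>1\<close> is either a sum of summands, or a monomial followed by a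
  cofactor \<open>s\<close> that is \<open>1\<close> or a sum polynomial. Unfolding these two alternatives down to the
  leaves, \<open>p \<times>\<^sub>r\<^sub>d r\<close> is the result of putting \<open>r\<close> in place of every leaf \<open>1\<close> of \<open>p\<close>. The idea
  is that the size of \<open>r\<close> alone tells where these copies of \<open>r\<close> start, because
  \<open>p \<times>\<^sub>r\<^sub>d r\<close> is strictly larger than \<open>r\<close> unless \<open>p = 1\<close> (\<open>times_rd_larger\<close>).

  The theorem is proved by induction on \<open>p\<close> (\<open>nrd_induct\<close>), comparing two factorisations
  \<open>p \<times>\<^sub>r\<^sub>d r = q \<times>\<^sub>r\<^sub>d r'\<close> with \<open>r\<close> and \<open>r'\<close> of the same size.

  \<^item> If \<open>p = 1\<close>, the product has the size of \<open>r'\<close>, so \<open>q = 1\<close>.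

  \<^item> If \<open>p = m * s\<close> with a monomial \<open>m\<close>, the product has just one summand, so \<open>q\<close> is
    not a sum either and \<open>q = k * t\<close> with a monomial \<open>k\<close>. Its list of factors is that of \<open>m\<close> followed
    by that of \<open>s \<times>\<^sub>r\<^sub>d r\<close>, which is a single factor larger than \<open>r\<close> if \<open>s\<close> is a sum, and the list
    of factors of \<open>r\<close> if \<open>s = 1\<close>. Comparing these lists from the right settles the case
    (\<open>monomial_prefix_unique\<close>).

  \<^item> If \<open>p\<close> is a sum, so is \<open>q\<close>. A summand of \<open>p\<close> other than \<open>1\<close> contributes exactly one summand
    to the product, and this is larger than \<open>r\<close>; a summand \<open>1\<close> contributes the summands of \<open>r\<close>, all
    at most as large as \<open>r\<close>. Since \<open>r\<close> and \<open>r'\<close> have the same size, both kinds can be compared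
    separately: the large summands by the induction hypothesis, the small ones by counting
    (\<open>repeat_summands_unique\<close>).
\<close>

section \<open>Summands, factors and size\<close>

lemma sum_mset_summands: "\<Sum>\<^sub># (summands p) = p"
  by (simp add: summands_def sum_mset_summands_trm simple_rep_nsb)

lemma summands_neq_empty: "summands p \<noteq> {#}"
  by (simp add: summands_def summands_trm_neq_empty)

lemma size_nsb_0: "size_nsb (0 :: 'x nsb) = 1" and size_nsb_1: "size_nsb (1 :: 'x nsb) = 1"
  by (transfer, simp)+

text \<open>Counting the binary symbols between the parts, one less than there are parts, makes the
  successor of the size additive.\<close>

lemma size_summands: "size_nsb p + 1 = (\<Sum>a\<in>#summands p. size_nsb a + 1)"
proof -
  have "term_size s + 1 = (\<Sum>a\<in>#summands_trm s. size_nsb a + 1)" if "simple s" for s :: "'x trm"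
    using that
  proof (induction s)
    case (Mul s t)
    then show ?case
      by (simp add: size_abs_nsb del: simple_Mul)
  qed (auto simp: size_abs_nsb size_nsb_0 size_nsb_1)
  then show ?thesis
    by (cases p rule: nsb_cases) (simp add: size_abs_nsb summands_abs)
qed

lemma size_factors: "size_nsb p + 1 = (\<Sum>a\<leftarrow>factors p. size_nsb a + 1)"
proof -
  have "term_size s + 1 = (\<Sum>a\<leftarrow>factors_trm s. size_nsb a + 1)" if "simple s" for s :: "'x trm"
    using that
  proof (induction s)
    case (Add s t)
    then show ?case
      by (simp add: size_abs_nsb del: simple_Add)
  qed (auto simp: size_abs_nsb size_nsb_0 size_nsb_1)
  then show ?thesis
    by (cases p rule: nsb_cases) (simp add: size_abs_nsb factors_abs)
qed

lemma size_summand_le: "a \<in># summands p \<Longrightarrow> size_nsb a \<le> size_nsb p"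
  using size_summands[of p] by (auto dest!: multi_member_split)

lemma size_factor_le: "a \<in> set (factors p) \<Longrightarrow> size_nsb a \<le> size_nsb p"
  using size_factors[of p] member_le_sum_list[of "size_nsb a + 1" "map (\<lambda>a. size_nsb a + 1) (factors p)"]
  by auto

lemma summands_mult:
  assumes "p \<noteq> 0" "p \<noteq> 1" "q \<noteq> 0" "q \<noteq> 1"
  shows "summands (p * q) = {#p * q#}"
proof (cases p rule: nsb_cases; cases q rule: nsb_cases)
  fix s t
  assume st: "simple s" "p = abs_nsb s" "simple t" "q = abs_nsb t"
  with assms have "simple (s \<otimes> t)"
    by (auto simp: abs_nsb_Zero abs_nsb_One)
  with st show ?thesis
    by (simp add: abs_nsb_Mul[symmetric] summands_abs del: simple_Mul)
qed

lemma factors_add: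
  assumes "p \<noteq> 0" "q \<noteq> 0"
  shows "factors (p + q) = [p + q]"
proof (cases p rule: nsb_cases; cases q rule: nsb_cases)
  fix s t
  assume st: "simple s" "p = abs_nsb s" "simple t" "q = abs_nsb t"
  with assms have "simple (s \<oplus> t)"
    by (auto simp: abs_nsb_Zero)
  with st show ?thesis
    by (simp add: abs_nsb_Add[symmetric] factors_abs del: simple_Add)
qed

lemma summands_sum:
  assumes "\<forall>a\<in>#M. a \<noteq> 0" "M \<noteq> {#}"
  shows "\<Sum>\<^sub># M \<noteq> 0 \<and> summands (\<Sum>\<^sub># M) = (\<Sum>a\<in>#M. summands a)"
  using assms
proof (induction M)
  case (add a M)
  then show ?case
    by (cases "M = {#}") (auto simp: summands_add add_neq_0)
qed simp

lemma factors_sum: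
  assumes "\<forall>a\<in>#M. a \<noteq> 0" "2 \<le> size M"
  shows "factors (\<Sum>\<^sub># M) = [\<Sum>\<^sub># M]"
proof -
  obtain a N where M: "M = add_mset a N"
    using assms(2) by (cases M) auto
  moreover from this have "\<Sum>\<^sub># N \<noteq> 0"
    using assms by (intro summands_sum[THEN conjunct1]) auto
  ultimately show ?thesis
    using assms by (simp add: factors_add)
qed

text \<open>In a noncommutative product, the size of a right factor fixes the place where it starts.\<close>

lemma mult_right_size_unique:
  assumes "factors a @ factors b = factors c @ factors d" "size_nsb b = size_nsb d"
  shows "a = c \<and> b = d"
proof -
  let ?weight = "\<lambda>xs. \<Sum>a\<leftarrow>xs. size_nsb a + 1"
  have "?weight (factors b) = ?weight (factors d)"
    using assms(2) by (simp only: flip: size_factors)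
  then have prefix: "us = []" if "us @ factors b = factors d \<or> us @ factors d = factors b" for us
    using that by (cases us) (auto dest!: arg_cong[where f = ?weight])
  obtain us where "us @ factors b = factors d \<or> us @ factors d = factors b"
    using assms(1) unfolding append_eq_append_conv2 by metis
  with prefix have "factors b = factors d"
    by fastforce
  with assms(1) show ?thesis
    by (metis append_same_eq prod_list_factors)
qed

lemma repeat_summands_unique:
  assumes "repeat_mset k (summands r) = repeat_mset l (summands r')" "size_nsb r = size_nsb r'"
  shows "k = l \<and> (k \<noteq> 0 \<longrightarrow> r = r')"
proof -
  have weight: "(\<Sum>a\<in>#repeat_mset k (summands r). size_nsb a + 1) = k * (size_nsb r + 1)"
    for k and r :: "'a nsb"
    by (induction k) (simp_all add: size_summands[of r, simplified])
  have "k * (size_nsb r + 1) = l * (size_nsb r + 1)"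
    using weight[of k r] weight[of l r'] assms by simp
  then have "k = l"
    unfolding mult_cancel2 by simp
  moreover have "r = r'" if "k \<noteq> 0"
  proof -
    have "summands r = summands r'"
      using assms(1) that \<open>k = l\<close> by (auto simp: multiset_eq_iff)
    then show ?thesis
      by (metis sum_mset_summands)
  qed
  ultimately show ?thesis by simp
qed


section \<open>The structure of polynomials\<close>

lemma sum_polys_subset_nrd: "sum_polys \<subseteq> nrd"
  using sum_poly_terms_subset by (auto simp: sum_polys_def nrd_def)

lemma summand_polys_subset_nrd: "product_polys \<union> indeterminates \<union> {1} \<subseteq> nrd"
proof -
  have "abs_nsb (Var x) \<in> nrd" for x :: 'x
    unfolding nrd_def by (intro imageI poly_terms.monomial monomial_terms.intros)
  moreover have "(1 :: 'x nsb) \<in> nrd"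
    unfolding nrd_def abs_nsb_One[symmetric] by (intro imageI poly_terms.One)
  ultimately show ?thesis
    using product_poly_terms_subset by (auto simp: product_polys_def indeterminates_def nrd_def)
qed

text \<open>Admitting the cofactor \<open>1\<close> treats monomials and all other product polynomials alike.\<close>

lemma nrd_monomial_prefix:
  assumes "p \<in> nrd" "p \<noteq> 0" "p \<noteq> 1" "p \<notin> sum_polys"
  obtains m s where "m \<in> monomials" "s \<in> insert 1 sum_polys" "p = m * s"
proof -
  obtain t where "p = abs_nsb t" "t \<in> poly_terms"
    using assms(1) by (auto simp: nrd_def)
  then consider "p \<in> monomials" | d where "product_decomp p d"
    using poly_term_cases[of t] assms by (auto simp: abs_nsb_Zero abs_nsb_One)
  then show ?thesis
  proof cases
    case 1
    then show ?thesis
      using that[of p 1] by simp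
  next
    case 2
    then show ?thesis
      using that[of "fst d" "snd d"] by (simp add: product_decomp_def)
  qed
qed

lemma sum_decomp_member:
  assumes "sum_decomp p M" "a \<in># M"
  shows "a \<in> nrd \<and> a \<noteq> 0 \<and> a \<notin> sum_polys"
proof -
  have "a \<in> product_polys \<union> indeterminates \<union> {1}"
    using assms by (auto simp: sum_decomp_def)
  then show ?thesis
    using summand_polys_subset_nrd summand_nonzero[of a] sum_product_disjoint by blast
qed

text \<open>A sum is larger than its summands, and \<open>m * s\<close> is larger than \<open>s\<close>.\<close>

lemma nrd_induct [consumes 2, case_names one mult sum]:
  assumes "p \<in> nrd" "p \<noteq> 0"
    and "P 1"
    and mult: "\<And>m s. m \<in> monomials \<Longrightarrow> s \<in> insert 1 sum_polys \<Longrightarrow> m * s \<in> nrd - {0, 1} \<Longrightarrow>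
      P s \<Longrightarrow> P (m * s)"
    and sum: "\<And>p M. p \<in> sum_polys \<Longrightarrow> sum_decomp p M \<Longrightarrow> (\<And>a. a \<in># M \<Longrightarrow> P a) \<Longrightarrow> P p"
  shows "P p"
  using assms(1,2)
proof (induction "size_nsb p" arbitrary: p rule: less_induct)
  case less
  show ?case
  proof (cases "p \<in> sum_polys")
    case True
    then obtain M where M: "sum_decomp p M"
      using sum_decomp_exists by blast
    with True show ?thesis
      by (rule sum) (use M sum_decomp_member less size_sum_decomp in blast)
  next
    case not_sum: False
    show ?thesis
    proof (cases "p = 1")
      case False
      then obtain m s where ms: "m \<in> monomials" "s \<in> insert 1 sum_polys" "p = m * s"
        using nrd_monomial_prefix not_sum less.prems by metis
      have "P s"
      proof (cases "s = 1")
        case False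
        then have "s \<in> sum_polys" "product_decomp p (m, s)"
          using ms by (auto simp: product_decomp_def)
        then show ?thesis
          using less.hyps[of s] size_product_decomp[of p "(m, s)"] sum_poly_neq_factors[of s]
            sum_polys_subset_nrd by auto
      qed (use assms(3) in simp)
      with ms show ?thesis
        using mult[of m s] less.prems \<open>p \<noteq> 1\<close> by simp
    qed (use assms(3) in simp)
  qed
qed


section \<open>The products\<close>

lemma times_rd_monomial_prefix:
  assumes "m \<in> monomials" "s \<in> insert 1 sum_polys" "r \<noteq> 0" "r \<noteq> 1"
  shows "(m * s) \<times>\<^sub>r\<^sub>d r = m * (s \<times>\<^sub>r\<^sub>d r)"
  using assms times_rd_product[of m s r] times_rd_monomial[of m r] times_rd_1(2)[of r] by auto

text \<open>At least one leaf \<open>1\<close> of \<open>p\<close> is replaced by a copy of \<open>r\<close>, and if \<open>p\<close> is not this leaf itself,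
  something is added or multiplied to this copy. The product differs from \<open>0\<close> and \<open>1\<close>, as needed
  for the sizes to add up in the next step.\<close>

lemma times_rd_larger:
  assumes "p \<in> nrd" "p \<noteq> 0" "r \<noteq> 0" "r \<noteq> 1"
  shows "p \<times>\<^sub>r\<^sub>d r \<noteq> 0 \<and> p \<times>\<^sub>r\<^sub>d r \<noteq> 1 \<and> (p = 1 \<or> size_nsb r < size_nsb (p \<times>\<^sub>r\<^sub>d r))"
  using assms(1,2)
proof (induction p rule: nrd_induct)
  case one
  then show ?case
    using assms by (simp add: times_rd_1)
next
  case (mult m s)
  have "m \<noteq> 0" "m \<noteq> 1"
    using mult monomials_neq by auto
  moreover have "size_nsb r \<le> size_nsb (s \<times>\<^sub>r\<^sub>d r)"
    using mult.IH by (auto simp: times_rd_1)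
  ultimately have "size_nsb r + 1 < size_nsb (m * (s \<times>\<^sub>r\<^sub>d r))"
    using mult.IH size_nsb_pos[of m] by (simp add: size_nsb_mult)
  then have "m * (s \<times>\<^sub>r\<^sub>d r) \<noteq> 0" "m * (s \<times>\<^sub>r\<^sub>d r) \<noteq> 1" "size_nsb r < size_nsb (m * (s \<times>\<^sub>r\<^sub>d r))"
    by (auto simp: size_nsb_0 size_nsb_1)
  then show ?case
    using mult assms by (simp add: times_rd_monomial_prefix)
next
  case (sum p M)
  have "2 \<le> size M"
    using sum.hyps(2) by (simp add: sum_decomp_def)
  then obtain a N where M: "M = add_mset a N" and N: "N \<noteq> {#}"
    by (cases M) fastforce+
  let ?R = "\<Sum>a\<in>#N. a \<times>\<^sub>r\<^sub>d r"
  have "?R \<noteq> 0"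
    using sum.IH M N by (intro summands_sum[THEN conjunct1]) auto
  moreover have "a \<times>\<^sub>r\<^sub>d r \<noteq> 0" "size_nsb r \<le> size_nsb (a \<times>\<^sub>r\<^sub>d r)"
    using sum.IH[of a] M by (auto simp: times_rd_1)
  ultimately have "size_nsb r + 1 < size_nsb (a \<times>\<^sub>r\<^sub>d r + ?R)"
    using size_nsb_pos[of ?R] by (simp add: size_nsb_add)
  moreover have "p \<times>\<^sub>r\<^sub>d r = a \<times>\<^sub>r\<^sub>d r + ?R"
    using times_rd_sum[OF sum.hyps assms(3,4)] M by simp
  ultimately show ?case
    by (auto simp: size_nsb_0 size_nsb_1)
qed

lemma parts_times_rd_monomial_prefix:
  assumes "m \<in> monomials" "s \<in> insert 1 sum_polys" "r \<noteq> 0" "r \<noteq> 1"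
  shows "summands ((m * s) \<times>\<^sub>r\<^sub>d r) = {#(m * s) \<times>\<^sub>r\<^sub>d r#}"
    and "factors ((m * s) \<times>\<^sub>r\<^sub>d r) = factors m @ factors (s \<times>\<^sub>r\<^sub>d r)"
proof -
  have "s \<in> nrd" "s \<noteq> 0"
    using assms(2) sum_polys_subset_nrd summand_polys_subset_nrd sum_poly_neq_factors[of s] by auto
  then have "s \<times>\<^sub>r\<^sub>d r \<noteq> 0" "s \<times>\<^sub>r\<^sub>d r \<noteq> 1"
    using times_rd_larger assms by blast+
  then show "summands ((m * s) \<times>\<^sub>r\<^sub>d r) = {#(m * s) \<times>\<^sub>r\<^sub>d r#}"
    and "factors ((m * s) \<times>\<^sub>r\<^sub>d r) = factors m @ factors (s \<times>\<^sub>r\<^sub>d r)"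
    using assms monomials_neq[of m]
    by (simp_all add: times_rd_monomial_prefix summands_mult factors_mult)
qed

lemma factors_times_rd_sum:
  assumes "p \<in> sum_polys" "r \<noteq> 0" "r \<noteq> 1"
  shows "factors (p \<times>\<^sub>r\<^sub>d r) = [p \<times>\<^sub>r\<^sub>d r]"
proof -
  obtain M where M: "sum_decomp p M"
    using assms(1) sum_decomp_exists by blast
  then show ?thesis
    unfolding times_rd_sum[OF assms(1) M assms(2,3)]
    using sum_decomp_member times_rd_larger assms(2,3)
    by (intro factors_sum) (auto simp: sum_decomp_def)
qed

lemma summands_times_rd_sum:
  assumes "p \<in> sum_polys" "sum_decomp p M" "r \<noteq> 0" "r \<noteq> 1"
  shows "summands (p \<times>\<^sub>r\<^sub>d r) = (\<Sum>a\<in>#M. summands (a \<times>\<^sub>r\<^sub>d r))"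
proof -
  have "\<forall>b\<in>#image_mset (\<lambda>a. a \<times>\<^sub>r\<^sub>d r) M. b \<noteq> 0" "M \<noteq> {#}"
    using sum_decomp_member[OF assms(2)] times_rd_larger assms by (auto simp: sum_decomp_def)
  then have "summands (\<Sum>a\<in>#M. a \<times>\<^sub>r\<^sub>d r) = (\<Sum>b\<in>#image_mset (\<lambda>a. a \<times>\<^sub>r\<^sub>d r) M. summands b)"
    by (intro summands_sum[THEN conjunct2]) auto
  then show ?thesis
    unfolding times_rd_sum[OF assms] by (simp add: multiset.map_comp comp_def)
qed

text \<open>The number of summands of a product thus shows whether a left factor other than \<open>1\<close> is a
  sum.\<close>

lemma size_summands_times_rd_sum:
  assumes "p \<in> sum_polys" "r \<noteq> 0" "r \<noteq> 1"
  shows "2 \<le> size (summands (p \<times>\<^sub>r\<^sub>d r))"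
proof -
  obtain M where M: "sum_decomp p M"
    using assms(1) sum_decomp_exists by blast
  have "size M \<le> size (\<Sum>a\<in>#M. summands (a \<times>\<^sub>r\<^sub>d r))"
  proof (induction M)
    case (add a M)
    then show ?case
      using summands_neq_empty[of "a \<times>\<^sub>r\<^sub>d r"] by (simp add: nonempty_has_size)
  qed simp
  then show ?thesis
    using M summands_times_rd_sum[OF assms(1) M assms(2,3)] by (simp add: sum_decomp_def)
qed

text \<open>The size of \<open>r\<close> separates the summands of \<open>p \<times>\<^sub>r\<^sub>d r\<close> that stem from the summands \<open>1\<close> of \<open>p\<close>
  from all others.\<close>

lemma large_and_small_summands:
  assumes "p \<in> sum_polys" "sum_decomp p M" "r \<noteq> 0" "r \<noteq> 1"
  shows "{#b \<in># summands (p \<times>\<^sub>r\<^sub>d r). size_nsb r < size_nsb b#} =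
      {#a \<times>\<^sub>r\<^sub>d r. a \<in># {#a \<in># M. a \<noteq> 1#}#}" (is "?large M")
    and "{#b \<in># summands (p \<times>\<^sub>r\<^sub>d r). \<not> size_nsb r < size_nsb b#} =
      repeat_mset (count M 1) (summands r)" (is "?small M")
proof -
  have one: "{#b \<in># summands r. size_nsb r < size_nsb b#} = {#}"
    "{#b \<in># summands r. \<not> size_nsb r < size_nsb b#} = summands r"
    using size_summand_le[of _ r] by (auto simp: filter_mset_eq_conv not_less)
  have other: "summands (a \<times>\<^sub>r\<^sub>d r) = {#a \<times>\<^sub>r\<^sub>d r#} \<and> size_nsb r < size_nsb (a \<times>\<^sub>r\<^sub>d r)"
    if "a \<in># M" "a \<noteq> 1" for a
  proof -
    note a = sum_decomp_member[OF assms(2) that(1)]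
    then obtain m s where "m \<in> monomials" "s \<in> insert 1 sum_polys" "a = m * s"
      using nrd_monomial_prefix \<open>a \<noteq> 1\<close> by metis
    with a that(2) show ?thesis
      using parts_times_rd_monomial_prefix times_rd_larger assms(3,4) by metis
  qed
  have "{#b \<in># \<Sum>a\<in>#N. summands (a \<times>\<^sub>r\<^sub>d r). size_nsb r < size_nsb b#} =
      {#a \<times>\<^sub>r\<^sub>d r. a \<in># {#a \<in># N. a \<noteq> 1#}#} \<and>
    {#b \<in># \<Sum>a\<in>#N. summands (a \<times>\<^sub>r\<^sub>d r). \<not> size_nsb r < size_nsb b#} =
      repeat_mset (count N 1) (summands r)"
    if "set_mset N \<subseteq> set_mset M" for N
    using that
  proof (induction N)
    case (add a N)
    then show ?case
      using one other[of a] by (cases "a = 1") (auto simp: times_rd_1)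
  qed simp
  from this[of M] show "?large M" "?small M"
    unfolding summands_times_rd_sum[OF assms] by auto
qed


section \<open>Cancellation\<close>

text \<open>This excludes that a monomial \<open>p\<close> and a product polynomial \<open>q = k * t\<close> with a sum \<open>t\<close> yield
  the same product. The single factor \<open>t \<times>\<^sub>r\<^sub>d r'\<close> at the end would be a factor of \<open>r\<close>, but it is
  larger than \<open>r'\<close>, which has the size of \<open>r\<close>.\<close>

lemma monomial_prefix_last:
  assumes "factors m @ factors r = factors k @ factors (t \<times>\<^sub>r\<^sub>d r')"
    and "t \<in> sum_polys" "r' \<noteq> 0" "r' \<noteq> 1" "size_nsb r = size_nsb r'"
  shows False
proof -
  have "factors r \<noteq> []"
    using size_factors[of r] by auto
  moreover have "last (factors m @ factors r) = t \<times>\<^sub>r\<^sub>d r'"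
    unfolding assms(1) using assms by (simp add: factors_times_rd_sum)
  ultimately have "t \<times>\<^sub>r\<^sub>d r' \<in> set (factors r)"
    by (metis last_appendR last_in_set)
  then have "size_nsb (t \<times>\<^sub>r\<^sub>d r') \<le> size_nsb r'"
    using assms(5) size_factor_le by metis
  moreover have "t \<in> nrd" "t \<noteq> 0" "t \<noteq> 1"
    using assms(2) sum_polys_subset_nrd sum_poly_neq_factors by blast+
  ultimately show False
    using times_rd_larger[of t r'] assms by simp
qed

lemma monomial_prefix_unique:
  assumes eq: "(m * s) \<times>\<^sub>r\<^sub>d r = (k * t) \<times>\<^sub>r\<^sub>d r'"
    and m: "m \<in> monomials" "s \<in> insert 1 sum_polys"
    and k: "k \<in> monomials" "t \<in> insert 1 sum_polys"
    and r: "r \<noteq> 0" "r \<noteq> 1" and r': "r' \<noteq> 0" "r' \<noteq> 1" and size: "size_nsb r = size_nsb r'"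
  shows "m = k \<and> s \<times>\<^sub>r\<^sub>d r = t \<times>\<^sub>r\<^sub>d r'"
proof -
  have factors: "factors m @ factors (s \<times>\<^sub>r\<^sub>d r) = factors k @ factors (t \<times>\<^sub>r\<^sub>d r')"
    using eq parts_times_rd_monomial_prefix(2) m k r r' by metis
  consider "s = 1" "t = 1" | "s = 1" "t \<in> sum_polys" | "s \<in> sum_polys" "t = 1"
    | "s \<in> sum_polys" "t \<in> sum_polys"
    using m k by blast
  then show ?thesis
  proof cases
    case 1
    with factors size show ?thesis
      by (simp add: times_rd_1 mult_right_size_unique)
  next
    case 2
    with factors show ?thesis
      using monomial_prefix_last[of m r k t r'] r' size by (simp add: times_rd_1)
  next
    case 3
    with factors show ?thesis
      using monomial_prefix_last[of k r' m s r] r size by (simp add: times_rd_1)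
  next
    case 4
    with factors r r' have "factors m = factors k" "s \<times>\<^sub>r\<^sub>d r = t \<times>\<^sub>r\<^sub>d r'"
      by (simp_all add: factors_times_rd_sum)
    then show ?thesis
      by (metis prod_list_factors)
  qed
qed

lemma image_mset_eq_imp_eq:
  assumes "image_mset f M = image_mset g N"
    and "\<And>x y. x \<in># M \<Longrightarrow> y \<in># N \<Longrightarrow> f x = g y \<Longrightarrow> x = y"
  shows "M = N"
  using assms
proof (induction M arbitrary: N)
  case (add x M)
  have "f x \<in># image_mset g N"
    using add.prems(1) by (metis image_mset_add_mset union_single_eq_member)
  then obtain y where y: "y \<in># N" "f x = g y"
    by auto
  then have "x = y"
    using add.prems(2) by simp
  obtain N' where N: "N = add_mset y N'"
    using y(1) by (meson multi_member_split)
  have "M = N'"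
    using add.prems N y by (intro add.IH) auto
  with N \<open>x = y\<close> show ?case
    by simp
qed simp

text \<open>The conclusion on \<open>r\<close> and \<open>r'\<close> comes from a summand \<open>1\<close> if there is one, and from any other
  summand if not.\<close>

lemma sum_unique:
  assumes p: "p \<in> sum_polys" "sum_decomp p M" and q: "q \<in> sum_polys" "sum_decomp q N"
    and r: "r \<noteq> 0" "r \<noteq> 1" and r': "r' \<noteq> 0" "r' \<noteq> 1" and size: "size_nsb r = size_nsb r'"
    and eq: "p \<times>\<^sub>r\<^sub>d r = q \<times>\<^sub>r\<^sub>d r'"
    and IH: "\<And>a b. a \<in># M \<Longrightarrow> b \<in># N \<Longrightarrow> a \<times>\<^sub>r\<^sub>d r = b \<times>\<^sub>r\<^sub>d r' \<Longrightarrow> a = b \<and> r = r'"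
  shows "p = q \<and> r = r'"
proof -
  define M' where "M' = {#a \<in># M. a \<noteq> 1#}"
  define N' where "N' = {#a \<in># N. a \<noteq> 1#}"
  have large: "{#a \<times>\<^sub>r\<^sub>d r. a \<in># M'#} = {#b \<times>\<^sub>r\<^sub>d r'. b \<in># N'#}"
    using large_and_small_summands(1)[OF p r] large_and_small_summands(1)[OF q r'] eq size
    by (simp add: M'_def N'_def)
  have M'_N': "M' = N'"
    by (rule image_mset_eq_imp_eq[OF large]) (use IH in \<open>auto simp: M'_def N'_def\<close>)
  have "repeat_mset (count M 1) (summands r) = repeat_mset (count N 1) (summands r')"
    using large_and_small_summands(2)[OF p r] large_and_small_summands(2)[OF q r'] eq size by simp
  then have count: "count M 1 = count N 1" "count M 1 \<noteq> 0 \<longrightarrow> r = r'"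
    using repeat_summands_unique size by blast+
  have "M = N"
  proof (rule multiset_eqI)
    fix a
    have "count M' a = count N' a"
      using M'_N' by simp
    with count(1) show "count M a = count N a"
      by (cases "a = 1") (auto simp: M'_def N'_def)
  qed
  then have "p = q"
    using p q by (simp add: sum_decomp_def)
  moreover have "r = r'"
  proof (cases "count M 1 = 0")
    case True
    then have "M' = M"
      by (auto simp: M'_def filter_mset_eq_conv count_eq_zero_iff)
    moreover obtain a where "a \<in># M"
      using p(2) by (cases M) (auto simp: sum_decomp_def)
    ultimately have "a \<times>\<^sub>r\<^sub>d r \<in># {#b \<times>\<^sub>r\<^sub>d r'. b \<in># N'#}"
      by (simp flip: large)
    then show ?thesis
      using IH \<open>a \<in># M\<close> by (auto simp: N'_def)
  qed (use count in simp)
  ultimately show ?thesis ..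
qed

theorem theorem4p16:
  fixes p q r r' :: "'x nsb"
  assumes "p \<in> nrd - {0}" and "q \<in> nrd - {0}" and "r \<in> nrd - {0}" and "r' \<in> nrd - {0}"
    and "r \<noteq> 1" and "r' \<noteq> 1"
    and "p \<times>\<^sub>r\<^sub>d r = q \<times>\<^sub>r\<^sub>d r'"
    and "size_nsb r = size_nsb r'"
  shows "p = q \<and> r = r'"
proof -
  have r: "r \<noteq> 0" "r \<noteq> 1" and r': "r' \<noteq> 0" "r' \<noteq> 1" and size: "size_nsb r = size_nsb r'"
    using assms by auto
  have "p \<in> nrd" "p \<noteq> 0" "q \<in> nrd" "q \<noteq> 0"
    using assms by auto
  then show ?thesis
    using assms(7)
  proof (induction p arbitrary: q rule: nrd_induct)
    case one
    then have "q = 1"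
      using times_rd_larger[of q r'] r' size by (auto simp: times_rd_1)
    with one show ?case
      by (simp add: times_rd_1)
  next
    case (mult m s)
    have summands: "summands (q \<times>\<^sub>r\<^sub>d r') = {#(m * s) \<times>\<^sub>r\<^sub>d r#}"
      using parts_times_rd_monomial_prefix(1)[OF mult.hyps(1,2) r] mult.prems(3) by simp
    have ms: "m * s \<in> nrd" "m * s \<noteq> 0" "m * s \<noteq> 1"
      using mult.hyps(3) by auto
    have "q \<noteq> 1"
      using times_rd_larger[OF ms(1,2) r] ms(3) mult.prems(3) size by (auto simp: times_rd_1)
    moreover have "q \<notin> sum_polys"
      using size_summands_times_rd_sum[of q r'] r' summands by auto
    ultimately obtain k t where kt: "k \<in> monomials" "t \<in> insert 1 sum_polys" "q = k * t"
      using nrd_monomial_prefix mult.prems(1,2) by metis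
    have "m = k" "s \<times>\<^sub>r\<^sub>d r = t \<times>\<^sub>r\<^sub>d r'"
      using monomial_prefix_unique[of m s r k t r'] mult kt r r' size by auto
    moreover have "t \<in> nrd" "t \<noteq> 0"
      using kt(2) sum_polys_subset_nrd summand_polys_subset_nrd sum_poly_neq_factors[of t] by auto
    ultimately show ?case
      using mult.IH[of t] kt(3) by simp
  next
    case (sum p M)
    have p: "p \<in> nrd" "p \<noteq> 0" "p \<noteq> 1"
      using sum.hyps(1) sum_polys_subset_nrd sum_poly_neq_factors by blast+
    have "q \<noteq> 1"
      using times_rd_larger[OF p(1,2) r] p(3) sum.prems(3) size by (auto simp: times_rd_1)
    have "q \<in> sum_polys"
    proof (rule ccontr)
      assume "q \<notin> sum_polys"
      then obtain k t where "k \<in> monomials" "t \<in> insert 1 sum_polys" "q = k * t"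
        using nrd_monomial_prefix sum.prems(1,2) \<open>q \<noteq> 1\<close> by metis
      then have "size (summands (p \<times>\<^sub>r\<^sub>d r)) = 1"
        using parts_times_rd_monomial_prefix(1)[of k t r'] r' sum.prems(3) by simp
      then show False
        using size_summands_times_rd_sum[OF sum.hyps(1) r] by simp
    qed
    then obtain N where N: "sum_decomp q N"
      using sum_decomp_exists by blast
    show ?case
    proof (rule sum_unique[OF sum.hyps \<open>q \<in> sum_polys\<close> N r r' size sum.prems(3)])
      fix a b
      assume "a \<in># M" "b \<in># N" "a \<times>\<^sub>r\<^sub>d r = b \<times>\<^sub>r\<^sub>d r'"
      then show "a = b \<and> r = r'"
        using sum.IH[of a b] sum_decomp_member[OF N] by blast
    qed
  qed
qed

end
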